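(* For every $n\ge1$, $$|\mathcal{RS}_n(132,231)|=n.$$
   Context: $\mathfrak{S}_n$ is the set of permutations of $\{1,\dots,n\}$, written in one-line notation $\pi=\pi_1\pi_2\dots\pi_n$. A permutation $\pi\in\mathfrak{S}_n$ is simsun if for every $3\le k\le n$, the subword of $\pi_1\pi_2\dots\pi_n$ consisting of the entries in $\{1,\dots,k\}$ (kept in their order) has no double descent, i.e. no three entries that are consecutive in that subword and in decreasing order. A permutation $\pi\in\mathfrak{S}_n$ avoids the pattern $\sigma\in\mathfrak{S}_k$ if there are no indices $i_1<i_2<\dots<i_k$ such that $\pi_{i_1}\pi_{i_2}\dots\pi_{i_k}$ is in the same relative order as $\sigma$. $\mathcal{RS}_n(\sigma,\tau)$ is the set of simsun permutations in $\mathfrak{S}_n$ avoiding both $\sigma$ and $\tau$. *)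

theory Defs
  imports Main "HOL-Combinatorics.Multiset_Permutations"
begin

text \<open>
  A permutation in one-line notation is the list of its values, so the set of
  permutations of \<open>{1, \<dots>, n}\<close> is \<open>permutations_of_set {1..n}\<close>. List positions count
  from 0, while the values are \<open>1, \<dots>, n\<close>.
\<close>

definition has_double_descent :: "nat list \<Rightarrow> bool" where
  "has_double_descent w \<longleftrightarrow>
     (\<exists>i. i + 2 < length w \<and> w ! i > w ! (i + 1) \<and> w ! (i + 1) > w ! (i + 2))"

definition simsun :: "nat list \<Rightarrow> bool" where
  "simsun p \<longleftrightarrow>
     (\<forall>k. 3 \<le> k \<and> k \<le> length p \<longrightarrow> \<not> has_double_descent (filter (\<lambda>x. x \<in> {1..k}) p))"

text \<open>The function \<open>f\<close> lists the positions \<open>i\<^sub>1 < \<dots> < i\<^sub>k\<close> of an occurrence of the pattern.\<close>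

definition contains_pattern :: "nat list \<Rightarrow> nat list \<Rightarrow> bool" where
  "contains_pattern p s \<longleftrightarrow>
     (\<exists>f :: nat \<Rightarrow> nat. strict_mono_on {..<length s} f \<and>
        (\<forall>a < length s. f a < length p) \<and>
        (\<forall>a < length s. \<forall>b < length s. p ! f a < p ! f b \<longleftrightarrow> s ! a < s ! b))"

definition RS :: "nat \<Rightarrow> nat list \<Rightarrow> nat list \<Rightarrow> nat list set" where
  "RS n s t = {p \<in> permutations_of_set {1..n}.
     simsun p \<and> \<not> contains_pattern p s \<and> \<not> contains_pattern p t}"

end

theory Submission imports Defs begin

text \<open>
  Avoiding both \<open>132\<close> and \<open>231\<close> means that the middle entry of a subsequence of length three is
  never its maximum. In particular a descent \<open>b > c\<close> that is preceded by an entry \<open>a\<close> must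
  be part of a double descent \<open>a > b > c\<close>, which a simsun permutation cannot have. So the
  only possible descent is at the first position: the permutation is some entry \<open>x\<close> followed by the
  other entries in increasing order. Conversely, a word that increases after its first entry keeps
  this shape when it is restricted to \<open>{1..k}\<close>, so it is simsun; and both patterns
  end in a descent with an entry in front of it, so it avoids them too. Hence the permutations
  in question correspond to their first entry \<open>x\<close>, for which there are \<open>n\<close> choices (\<open>x = 1\<close>
  gives the identity).
\<close>

text \<open>
  A double descent contains a descent whose top is not the first entry of the word.
\<close>
lemma sorted_tl_imp_no_double_descent:
  assumes "sorted (tl w)"
  shows "\<not> has_double_descent w"
proof
  assume "has_double_descent w"
  then obtain i where i: "i + 2 < length w" "w ! (i + 1) > w ! (i + 2)"
    unfolding has_double_descent_def by blast
  then have "tl w ! i \<le> tl w ! (i + 1)"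
    using assms by (intro sorted_nth_mono) auto
  with i show False by (simp add: nth_tl)
qed

lemma sorted_tl_filter:
  assumes "sorted (tl p)"
  shows "sorted (tl (filter P p))"
proof (cases p)
  case (Cons x ys)
  then have "sorted (filter P ys)" using assms by (simp add: sorted_wrt_filter)
  then show ?thesis using Cons by (auto intro: sorted_tl)
qed simp

lemma sorted_tl_imp_simsun: "sorted (tl p) \<Longrightarrow> simsun p"
  by (simp add: simsun_def sorted_tl_imp_no_double_descent sorted_tl_filter)

text \<open>
  In an occurrence of \<open>s\<close> the entry \<open>s ! 0\<close> already uses up a position of \<open>p\<close>, so the descent
  \<open>s ! 1 > s ! 2\<close> would have to occur inside \<open>tl p\<close>.
\<close>
lemma sorted_tl_avoids_noninitial_descent:
  assumes "sorted (tl p)" "2 < length s" "s ! 2 < s ! 1"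
  shows "\<not> contains_pattern p s"
proof
  assume "contains_pattern p s"
  then obtain f where f: "strict_mono_on {..<length s} f" "\<forall>a < length s. f a < length p"
      "\<forall>a < length s. \<forall>b < length s. p ! f a < p ! f b \<longleftrightarrow> s ! a < s ! b"
    unfolding contains_pattern_def by blast
  have lt: "f 0 < f 1" "f 1 < f 2"
    using assms(2) by (auto intro!: strict_mono_onD[OF f(1)])
  have len: "f 2 < length p" using f(2) assms(2) by blast
  have "tl p ! (f 1 - 1) \<le> tl p ! (f 2 - 1)"
    using lt len assms(1) by (intro sorted_nth_mono) auto
  then have "p ! f 1 \<le> p ! f 2" using lt len by (simp add: nth_tl)
  moreover have "p ! f 2 < p ! f 1" using f(3) assms(2,3) by simp
  ultimately show False by simp
qed

lemma contains_pattern_consecutive: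
  assumes "i + length s \<le> length p"
    and "\<And>a b. a < length s \<Longrightarrow> b < length s \<Longrightarrow> p ! (i + a) < p ! (i + b) \<longleftrightarrow> s ! a < s ! b"
  shows "contains_pattern p s"
  unfolding contains_pattern_def
  using assms by (intro exI[of _ "\<lambda>a. i + a"]) (auto simp: strict_mono_on_def)

text \<open>
  If three consecutive entries have their maximum in the middle, the order of the outer two
  decides which of the two patterns they form.
\<close>
lemma consecutive_peak_imp_132_or_231:
  assumes "distinct p" "i + 2 < length p"
    and "p ! i < p ! (i + 1)" "p ! (i + 2) < p ! (i + 1)"
  shows "contains_pattern p [1, 3, 2] \<or> contains_pattern p [2, 3, 1]"
proof -
  have "p ! i \<noteq> p ! (i + 2)"
    using assms(1,2) by (simp add: nth_eq_iff_index_eq)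
  then consider "p ! i < p ! (i + 2)" | "p ! (i + 2) < p ! i" by linarith
  then show ?thesis
  proof cases
    case 1
    have "contains_pattern p [1, 3, 2]"
      using 1 assms
      by (intro contains_pattern_consecutive[of i])
        (auto simp: less_Suc_eq numeral_3_eq_3 numeral_2_eq_2)
    then show ?thesis ..
  next
    case 2
    have "contains_pattern p [2, 3, 1]"
      using 2 assms
      by (intro contains_pattern_consecutive[of i])
        (auto simp: less_Suc_eq numeral_3_eq_3 numeral_2_eq_2)
    then show ?thesis ..
  qed
qed

lemma RS_132_231_imp_sorted_tl:
  assumes "p \<in> RS n [1, 3, 2] [2, 3, 1]"
  shows "sorted (tl p)"
proof (rule ccontr)
  assume "\<not> sorted (tl p)"
  then obtain i where "Suc i < length (tl p)" "tl p ! Suc i < tl p ! i"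
    by (auto simp: sorted_iff_nth_Suc not_le)
  then have i: "i + 2 < length p" "p ! (i + 2) < p ! (i + 1)"
    by (auto simp: nth_tl)
  have p: "set p = {1..n}" "distinct p" "simsun p"
      "\<not> contains_pattern p [1, 3, 2]" "\<not> contains_pattern p [2, 3, 1]"
    using assms by (auto simp: RS_def permutations_of_set_def)
  have len: "length p = n" using p distinct_card by fastforce
  have "p ! i \<noteq> p ! (i + 1)" using p(2) i(1) by (simp add: nth_eq_iff_index_eq)
  then have "p ! (i + 1) < p ! i"
    using consecutive_peak_imp_132_or_231[of p i] p i by linarith
  then have "has_double_descent p" unfolding has_double_descent_def using i by blast
  \<comment> \<open>The whole permutation is its own restriction to \<open>{1..n}\<close>, and three entries force \<open>3 \<le> n\<close>.\<close>
  moreover have "filter (\<lambda>x. x \<in> {1..n}) p = p"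
    using p(1) by (intro filter_True) auto
  moreover have "3 \<le> n" using i(1) len by simp
  ultimately show False using p(3) len unfolding simsun_def by auto
qed

lemma RS_132_231_iff_sorted_tl:
  "p \<in> RS n [1, 3, 2] [2, 3, 1] \<longleftrightarrow> p \<in> permutations_of_set {1..n} \<and> sorted (tl p)"
proof
  assume "p \<in> RS n [1, 3, 2] [2, 3, 1]"
  then show "p \<in> permutations_of_set {1..n} \<and> sorted (tl p)"
    using RS_132_231_imp_sorted_tl by (simp add: RS_def)
next
  assume "p \<in> permutations_of_set {1..n} \<and> sorted (tl p)"
  then show "p \<in> RS n [1, 3, 2] [2, 3, 1]"
    by (simp add: RS_def sorted_tl_imp_simsun sorted_tl_avoids_noninitial_descent)
qed

lemma permutations_of_set_sorted_tl:
  assumes "finite A" "A \<noteq> {}"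
  shows "{p \<in> permutations_of_set A. sorted (tl p)} =
    (\<lambda>x. x # sorted_list_of_set (A - {x})) ` A" (is "?L = ?R")
proof
  show "?L \<subseteq> ?R"
  proof
    fix p assume "p \<in> ?L"
    then have p: "set p = A" "distinct p" "sorted (tl p)"
      by (auto simp: permutations_of_set_def)
    obtain x ys where eq: "p = x # ys" using p(1) assms(2) by (cases p) auto
    have "set ys = A - {x}" using p eq by auto
    then have "ys = sorted_list_of_set (A - {x})"
      using p eq sorted_list_of_set.idem_if_sorted_distinct[of ys] by simp
    then show "p \<in> ?R" using eq p(1) by auto
  qed
  show "?R \<subseteq> ?L" using assms(1) by (auto simp: permutations_of_set_def)
qed

theorem lemma7p5:
  fixes n :: nat
  assumes "n \<ge> 1"
  shows "card (RS n [1, 3, 2] [2, 3, 1]) = n"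
proof -
  have "RS n [1, 3, 2] [2, 3, 1] = {p \<in> permutations_of_set {1..n}. sorted (tl p)}"
    using RS_132_231_iff_sorted_tl by blast
  also have "\<dots> = (\<lambda>x. x # sorted_list_of_set ({1..n} - {x})) ` {1..n}"
    using assms by (intro permutations_of_set_sorted_tl) auto
  finally show ?thesis by (simp add: card_image inj_on_def)
qed

end
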